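(* Let $\alpha>-1$, let $c_1,\ldots,c_r>0$ with $c_i\neq c_j$ whenever $i\neq j$, and let $L^{[2]}_{\vec{n}}$ be the multiple Laguerre polynomials of the second kind with parameters $\alpha$, $c_1,\ldots,c_r$. Suppose $\vec{n}=(n_1,\ldots,n_r)$ with $n_j=\lfloor q_jn\rfloor$, where $q_j>0$ and $q_1+\cdots+q_r=1$, so that $|\vec{n}|/n\to1$ as $n\to\infty$, where $|\vec{n}|=n_1+\cdots+n_r$. Then \[ \lim_{n\to\infty}(-1)^{|\vec{n}|}c_1^{n_1}\cdots c_r^{n_r}\frac{L^{[2]}_{\vec{n}}(z/n)}{(\alpha+1)_{|\vec{n}|}}=\bigl((q_1c_1+\cdots+q_rc_r)z\bigr)^{-\alpha/2}J_\alpha\bigl(2\sqrt{(q_1c_1+\cdots+q_rc_r)z}\bigr), \] uniformly on compact subsets of $\mathbb{C}$.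
   Context: Notation: $(a)_k=a(a+1)\cdots(a+k-1)$, $(a)_0=1$, is the Pochhammer symbol, and $J_\alpha$ is the Bessel function of the first kind of order $\alpha$. For a multi-index $\vec{n}=(n_1,\ldots,n_r)$ of nonnegative integers, the multiple Laguerre polynomial of the second kind $L^{[2]}_{\vec{n}}$ is the polynomial of degree $|\vec{n}|$ given by the Rodrigues formula \[ (-1)^{|\vec{n}|}\prod_{j=1}^r c_j^{n_j}\;x^\alpha L^{[2]}_{\vec{n}}(x)=\prod_{j=1}^r\left(e^{c_jx}\frac{d^{n_j}}{dx^{n_j}}e^{-c_jx}\right)x^{|\vec{n}|+\alpha}, \] where the product on the right is a composition of differential operators, each consisting of multiplication by $e^{-c_jx}$, then differentiation $n_j$ times, then multiplication by $e^{c_jx}$, all applied to $x^{|\vec{n}|+\alpha}$. These polynomials satisfy \[ \int_0^\infty L^{[2]}_{\vec{n}}(x)\,x^k\,x^\alpha e^{-c_jx}\,dx=0,\qquad 0\le k\le n_j-1,\ 1\le j\le r. \]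
   Formalization: The limit is corrected by a factor Γ(α+1) on the right-hand side: at z=0 the left side equals 1 for every n, while the printed right side equals 1/Γ(α+1), so the printed formula fails unless Γ(α+1)=1 (e.g. it fails for α=2). *)

theory Defs
  imports "HOL-Complex_Analysis.Complex_Analysis"
begin

definition multi_size :: "nat \<Rightarrow> (nat \<Rightarrow> nat) \<Rightarrow> nat" where
  "multi_size r n = (\<Sum>j=1..r. n j)"

definition laguerre2_op :: "real \<Rightarrow> nat \<Rightarrow> (real \<Rightarrow> real) \<Rightarrow> real \<Rightarrow> real" where
  "laguerre2_op c m f = (\<lambda>x. exp (c * x) * (deriv ^^ m) (\<lambda>t. exp (- c * t) * f t) x)"

text \<open>The operator with index 1 is the outermost one.\<close>

definition laguerre2_rodrigues ::
  "real \<Rightarrow> nat \<Rightarrow> (nat \<Rightarrow> real) \<Rightarrow> (nat \<Rightarrow> nat) \<Rightarrow> real \<Rightarrow> real" where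
  "laguerre2_rodrigues \<alpha> r c n =
     foldr (\<lambda>j. laguerre2_op (c j) (n j)) [1..<Suc r] (\<lambda>x. x powr (real (multi_size r n) + \<alpha>))"

text \<open>
  The Rodrigues formula is imposed for positive \<open>x\<close> only, where the real powers are smooth.
\<close>

definition is_mult_laguerre2 ::
  "real \<Rightarrow> nat \<Rightarrow> (nat \<Rightarrow> real) \<Rightarrow> (nat \<Rightarrow> nat) \<Rightarrow> real poly \<Rightarrow> bool" where
  "is_mult_laguerre2 \<alpha> r c n p \<longleftrightarrow>
     degree p = multi_size r n \<and>
     (\<forall>x>0. (-1) ^ multi_size r n * (\<Prod>j=1..r. c j ^ n j) * x powr \<alpha> * poly p x
            = laguerre2_rodrigues \<alpha> r c n x)"

definition mult_laguerre2 ::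
  "real \<Rightarrow> nat \<Rightarrow> (nat \<Rightarrow> real) \<Rightarrow> (nat \<Rightarrow> nat) \<Rightarrow> real poly" where
  "mult_laguerre2 \<alpha> r c n = (THE p. is_mult_laguerre2 \<alpha> r c n p)"

text \<open>
  The description above determines the polynomial. The polynomial factor of
  \<open>exp (- c * x) * x powr a * p x\<close> changes under differentiation as follows.
\<close>

definition laguerre2_step :: "real \<Rightarrow> real \<Rightarrow> real poly \<Rightarrow> real poly" where
  "laguerre2_step c a p = smult a p + pCons 0 (pderiv p) - smult c (pCons 0 p)"

lemma coeff_laguerre2_step:
  "coeff (laguerre2_step c a p) i =
     (a + real i) * coeff p i - (case i of 0 \<Rightarrow> 0 | Suc k \<Rightarrow> c * coeff p k)"
  by (auto simp: laguerre2_step_def coeff_pCons coeff_pderiv algebra_simps split: nat.split)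

lemma degree_laguerre2_step:
  assumes "c \<noteq> 0" "p \<noteq> 0" shows "degree (laguerre2_step c a p) = Suc (degree p)" "laguerre2_step c a p \<noteq> 0"
proof -
  have "coeff (laguerre2_step c a p) (Suc (degree p)) \<noteq> 0"
    using assms by (simp add: coeff_laguerre2_step coeff_eq_0)
  moreover have "degree (laguerre2_step c a p) \<le> Suc (degree p)"
    by (rule degree_le) (auto simp: coeff_laguerre2_step coeff_eq_0 split: nat.split)
  ultimately show "degree (laguerre2_step c a p) = Suc (degree p)" "laguerre2_step c a p \<noteq> 0"
    using le_degree by (force intro: antisym)+
qed

lemma deriv_laguerre2_step:
  assumes "\<And>x. x > 0 \<Longrightarrow> g x = exp (- c * x) * x powr a * poly p x" "x > (0::real)"
  shows "deriv g x = exp (- c * x) * x powr (a - 1) * poly (laguerre2_step c a p) x"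
proof -
  have "((\<lambda>x. exp (- c * x) * x powr a * poly p x) has_field_derivative
      exp (- c * x) * x powr (a - 1) * poly (laguerre2_step c a p) x) (at x)"
    using assms(2)
    by (auto intro!: derivative_eq_intros simp: laguerre2_step_def algebra_simps powr_diff)
  then have "(g has_field_derivative exp (- c * x) * x powr (a - 1) * poly (laguerre2_step c a p) x) (at x)"
    by (rule DERIV_cong_ev[THEN iffD1, rotated -1])
       (use assms in \<open>auto intro!: eventually_mono[OF eventually_nhds_in_open[of "{0<..}" x]]\<close>)
  then show ?thesis by (rule DERIV_imp_deriv)
qed

lemma deriv_laguerre2_steps:
  assumes "\<And>x. x > 0 \<Longrightarrow> g x = exp (- c * x) * x powr a * poly p x" "c \<noteq> 0" "p \<noteq> 0"
  shows "\<exists>q. q \<noteq> 0 \<and> degree q = degree p + m \<and> coeff q 0 = (\<Prod>i<m. a - real i) * coeff p 0 \<and>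
    (\<forall>x>0. (deriv ^^ m) g x = exp (- c * x) * x powr (a - real m) * poly q x)"
proof (induction m)
  case 0
  show ?case using assms by auto
next
  case (Suc m)
  then obtain q where q: "q \<noteq> 0" "degree q = degree p + m" "coeff q 0 = (\<Prod>i<m. a - real i) * coeff p 0"
    "\<And>x. x > 0 \<Longrightarrow> (deriv ^^ m) g x = exp (- c * x) * x powr (a - real m) * poly q x" by blast
  show ?case
    by (rule exI[of _ "laguerre2_step c (a - real m) q"])
      (use q degree_laguerre2_step[OF \<open>c \<noteq> 0\<close> q(1)] deriv_laguerre2_step[OF q(4)] in
        \<open>auto simp: coeff_laguerre2_step algebra_simps\<close>)
qed

lemma foldr_laguerre2_op:
  assumes "\<And>j. j \<in> set js \<Longrightarrow> c j \<noteq> 0"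
  shows "\<exists>q. q \<noteq> 0 \<and> degree q = sum_list (map n js) \<and> coeff q 0 = (\<Prod>i<sum_list (map n js). b - real i) \<and>
    (\<forall>x>0. foldr (\<lambda>j. laguerre2_op (c j) (n j)) js (\<lambda>x. x powr b) x
       = x powr (b - real (sum_list (map n js))) * poly q x)"
  using assms
proof (induction js)
  case Nil
  show ?case by (rule exI[of _ 1]) auto
next
  case (Cons j js)
  let ?s = "sum_list (map n js)"
  let ?f = "foldr (\<lambda>j. laguerre2_op (c j) (n j)) js (\<lambda>x. x powr b)"
  from Cons obtain q where q: "q \<noteq> 0" "degree q = ?s" "coeff q 0 = (\<Prod>i<?s. b - real i)"
    "\<And>x. x > 0 \<Longrightarrow> ?f x = x powr (b - real ?s) * poly q x" by auto
  have "\<And>x. x > 0 \<Longrightarrow> exp (- c j * x) * ?f x = exp (- c j * x) * x powr (b - real ?s) * poly q x"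
    using q by simp
  moreover have cj: "c j \<noteq> 0" using Cons.prems by simp
  ultimately obtain p where
    p: "p \<noteq> 0" "degree p = ?s + n j" "coeff p 0 = (\<Prod>i<n j. b - real ?s - real i) * coeff q 0"
    "\<forall>x>0. (deriv ^^ n j) (\<lambda>x. exp (- c j * x) * ?f x) x = exp (- c j * x) * x powr (b - real ?s - real (n j)) * poly p x"
    using deriv_laguerre2_steps[of "\<lambda>x. exp (- c j * x) * ?f x" "c j" "b - real ?s" q "n j"] q(1,2) by auto
  have *: "(\<Prod>i<?s + m. b - real i) = (\<Prod>i<?s. b - real i) * (\<Prod>i<m. b - real ?s - real i)" for m
    by (induction m) (auto simp: algebra_simps)
  have 1: "coeff p 0 = (\<Prod>i<sum_list (map n (j # js)). b - real i)"
    using p(3) q(3) *[of "n j"] by (simp add: mult.commute add.commute)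
  have 2: "foldr (\<lambda>j. laguerre2_op (c j) (n j)) (j # js) (\<lambda>x. x powr b) x
      = x powr (b - real (sum_list (map n (j # js)))) * poly p x" if "x > 0" for x
  proof -
    have "foldr (\<lambda>j. laguerre2_op (c j) (n j)) (j # js) (\<lambda>x. x powr b) x =
       exp (c j * x) * (exp (- c j * x) * x powr (b - real ?s - real (n j)) * poly p x)"
      using p(4) that by (simp add: laguerre2_op_def)
    also have "\<dots> = x powr (b - real ?s - real (n j)) * poly p x"
      by (simp add: mult.assoc[symmetric] exp_add[symmetric])
    finally show ?thesis by (simp add: algebra_simps)
  qed
  show ?case
    by (intro exI[of _ p] conjI) (use p 1 2 in \<open>auto\<close>)
qed

lemma sum_list_multi_size: "sum_list (map n [1..<Suc r]) = multi_size r n"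
  unfolding multi_size_def by (metis atLeastLessThanSuc_atLeastAtMost interv_sum_list_conv_sum_set_nat set_upt)

lemma mult_laguerre2_ex:
  assumes "\<And>j. j \<in> {1..r} \<Longrightarrow> c j > 0"
  shows "\<exists>p. is_mult_laguerre2 \<alpha> r c n p \<and>
     (-1) ^ multi_size r n * (\<Prod>j=1..r. c j ^ n j) * poly p 0 = pochhammer (\<alpha> + 1) (multi_size r n)"
proof -
  let ?N = "multi_size r n"
  let ?k = "(-1) ^ ?N * (\<Prod>j=1..r. c j ^ n j) :: real"
  have k: "?k \<noteq> 0" using assms by (force simp: prod_zero_iff)
  have "\<And>j. j \<in> set [1..<Suc r] \<Longrightarrow> c j \<noteq> 0" using assms by force
  from foldr_laguerre2_op[of "[1..<Suc r]" c n "real ?N + \<alpha>", OF this]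
  obtain q where q: "q \<noteq> 0" "degree q = ?N" "coeff q 0 = (\<Prod>i<?N. real ?N + \<alpha> - real i)"
    "\<forall>x>0. laguerre2_rodrigues \<alpha> r c n x = x powr \<alpha> * poly q x"
    unfolding sum_list_multi_size laguerre2_rodrigues_def by auto
  have "(\<Prod>i<?N. real ?N + \<alpha> - real i) = (\<Prod>i<?N. \<alpha> + 1 + real i)"
    by (rule prod.reindex_bij_witness[of _ "\<lambda>i. ?N - Suc i" "\<lambda>i. ?N - Suc i"]) (auto simp: of_nat_diff)
  then have c0: "coeff q 0 = pochhammer (\<alpha> + 1) ?N"
    using q(3) by (simp add: pochhammer_prod atLeast0LessThan)
  show ?thesis
    by (rule exI[of _ "smult (inverse ?k) q"])
      (use k q c0 in \<open>auto simp: is_mult_laguerre2_def poly_0_coeff_0 field_simps\<close>)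
qed

lemma mult_laguerre2_unique:
  assumes "\<And>j. j \<in> {1..r} \<Longrightarrow> c j > 0" "is_mult_laguerre2 \<alpha> r c n p" "is_mult_laguerre2 \<alpha> r c n q"
  shows "p = q"
proof -
  define k where "k = (-1) ^ multi_size r n * (\<Prod>j=1..r. c j ^ n j)"
  have "k \<noteq> (0::real)" unfolding k_def
    using assms(1) by (force simp: prod_zero_iff)
  moreover have "k * x powr \<alpha> * poly p x = k * x powr \<alpha> * poly q x" if "x > 0" for x
    using assms(2,3) that unfolding is_mult_laguerre2_def k_def by metis
  ultimately have "poly (p - q) x = 0" if "x > 0" for x
    using that by auto
  then have "{0<..} \<subseteq> {x. poly (p - q) x = 0}" by auto
  then have "infinite {x. poly (p - q) x = 0}" using infinite_Ioi finite_subset by blast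
  then show ?thesis using poly_roots_finite[of "p - q"] by auto
qed

lemma mult_laguerre2_ex1:
  assumes "\<And>j. j \<in> {1..r} \<Longrightarrow> c j > 0"
  shows "\<exists>!p. is_mult_laguerre2 \<alpha> r c n p"
proof -
  obtain p where p: "is_mult_laguerre2 \<alpha> r c n p"
    using mult_laguerre2_ex[of r c \<alpha> n] assms by blast
  then show ?thesis
  proof (rule ex1I)
    fix q assume "is_mult_laguerre2 \<alpha> r c n q"
    with p show "q = p" using mult_laguerre2_unique[of r c \<alpha> n q p] assms by simp
  qed
qed

lemma is_mult_laguerre2_mult_laguerre2:
  assumes "\<And>j. j \<in> {1..r} \<Longrightarrow> c j > 0"
  shows "is_mult_laguerre2 \<alpha> r c n (mult_laguerre2 \<alpha> r c n)"
  unfolding mult_laguerre2_def by (rule theI') (rule mult_laguerre2_ex1[OF assms])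

text \<open>
  The Bessel function of the first kind, on the principal branch. Since \<open>0 powr 0 = 0\<close> for complex
  numbers, the value of the power factor has to be set to 1 when both arguments vanish.
\<close>

definition bessel_J :: "complex \<Rightarrow> complex \<Rightarrow> complex" where
  "bessel_J \<nu> z =
     (if z = 0 \<and> \<nu> = 0 then 1 else (z / 2) powr \<nu>) *
     (\<Sum>k. (-1) ^ k / (fact k * Gamma (\<nu> + of_nat k + 1)) * (z / 2) ^ (2 * k))"

text \<open>
  Two remarks on \<open>w powr (-\<alpha>/2) * bessel_J \<alpha> (2 * csqrt w)\<close> as a limit function. Off 0 the branch cuts
  cancel and it equals an entire power series in \<open>w\<close>, but at 0 it evaluates to 0, so the entire
  function it stands for is obtained with \<^const>\<open>remove_sings\<close>. That function has the value
  \<open>1 / Gamma (\<alpha> + 1)\<close> at 0, whereas the Laguerre polynomials normalised by the Pochhammer symbol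
  have the value 1 there; the factor \<open>Gamma (\<alpha> + 1)\<close> in the limit accounts for this.
\<close>

end

theory Submission
  imports Defs
begin

text \<open>
  In the Rodrigues formula, differentiating \<open>exp (- c * x)\<close> times a series
  \<open>\<Sum>i. e i / Gamma (a + i + 1) * x powr (a + i)\<close> lowers \<open>a\<close> by one and multiplies the
  generating series of \<open>e\<close> by \<open>1 - c * X\<close>. Hence the normalised polynomial at \<open>z / n\<close> is
  \<open>\<Sum>i. b\<^sub>i z^i / pochhammer (\<alpha> + 1) i\<close>, where \<open>b\<^sub>i\<close> are the coefficients of
  \<open>\<Prod>j. (1 - c j * X / n) ^ n\<^sub>j\<close>. With \<open>s = (\<Sum>j. q j * c j)\<close>, they converge to those of
  \<open>exp (- s * X)\<close> and, since \<open>n\<^sub>j \<le> q j * n\<close>, are dominated by those of \<open>exp (s * X)\<close>, so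
  Tannery's theorem applies.
\<close>

section \<open>Coefficients of the Rodrigues polynomials\<close>

text \<open>In \<open>coeff_laguerre2_step\<close>, coefficient i is multiplied by
  \<open>a + i\<close>, and \<open>(a + i) * Gamma (a + i) = Gamma (a + i + 1)\<close> absorbs this
  factor into the Gamma normalisation. What is left of one differentiation is multiplication of the
  generating series by \<open>1 - c * X\<close>. The bound \<open>a - real m > -1\<close> keeps
  every Gamma argument positive.\<close>

lemma deriv_steps_coeff:
  fixes e :: "real fps"
  assumes g: "\<And>x. x > 0 \<Longrightarrow> g x = exp (- c * x) * x powr a * poly p x"
    and e: "\<And>i. coeff p i * Gamma (a + real i + 1) = fps_nth e i"
    and a: "a - real m > -1"
  shows "\<exists>q. (\<forall>x>0. (deriv ^^ m) g x = exp (- c * x) * x powr (a - real m) * poly q x) \<and>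
    (\<forall>i. coeff q i * Gamma (a - real m + real i + 1) = fps_nth ((1 - fps_const c * fps_X) ^ m * e) i)"
  using a
proof (induction m)
  case 0
  show ?case using g e by auto
next
  case (Suc m)
  then have "a - real m > -1" by simp
  with Suc.IH obtain q where q: "\<And>x. x > 0 \<Longrightarrow> (deriv ^^ m) g x = exp (- c * x) * x powr (a - real m) * poly q x"
    "\<And>i. coeff q i * Gamma (a - real m + real i + 1) = fps_nth ((1 - fps_const c * fps_X) ^ m * e) i"
    by blast
  let ?f = "(1 - fps_const c * fps_X) ^ m * e"
  have "coeff (laguerre2_step c (a - real m) q) i * Gamma (a - real (Suc m) + real i + 1) =
      fps_nth ((1 - fps_const c * fps_X) ^ Suc m * e) i" for i
  proof -
    let ?y = "a - real m + real i"
    have y: "?y > 0" using Suc.prems by simp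
    then have "Gamma (?y + 1) = ?y * Gamma ?y"
      by (subst Gamma_plus1) (auto dest: nonpos_Ints_nonpos)
    \<comment> \<open>For \<open>i = Suc k\<close>, \<open>?y\<close> equals
      \<open>a - real m + real k + 1\<close>, so lowering the exponent by one is exactly the index
      shift caused by multiplication with X.\<close>
    moreover have "coeff (laguerre2_step c (a - real m) q) i * Gamma ?y =
        coeff q i * (?y * Gamma ?y) -
        (case i of 0 \<Rightarrow> 0 | Suc k \<Rightarrow> c * (coeff q k * Gamma (a - real m + real k + 1)))"
      by (cases i) (simp_all add: coeff_laguerre2_step algebra_simps)
    ultimately have "coeff (laguerre2_step c (a - real m) q) i * Gamma ?y =
        coeff q i * Gamma (?y + 1) -
        (case i of 0 \<Rightarrow> 0 | Suc k \<Rightarrow> c * (coeff q k * Gamma (a - real m + real k + 1)))"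
      by simp
    also have "\<dots> = fps_nth (?f - fps_const c * (fps_X * ?f)) i"
      unfolding q(2) by (cases i) (simp_all add: mult.assoc)
    also have "?f - fps_const c * (fps_X * ?f) = (1 - fps_const c * fps_X) ^ Suc m * e"
      by (simp add: algebra_simps)
    also have "?y = a - real (Suc m) + real i + 1" by simp
    finally show ?thesis .
  qed
  moreover have "(deriv ^^ Suc m) g x =
      exp (- c * x) * x powr (a - real (Suc m)) * poly (laguerre2_step c (a - real m) q) x" if "x > 0" for x
    using deriv_laguerre2_step[OF q(1) that] by (simp add: algebra_simps)
  ultimately show ?case by blast
qed

text \<open>The start \<open>x powr b\<close> has the constant generating series
  \<open>Gamma (b + 1)\<close>. Each operator multiplies by \<open>exp (- c j * x)\<close> before
  differentiating and cancels this factor afterwards, so its whole effect on the series is the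
  factor \<open>(1 - c j * X) ^ n j\<close>.\<close>

lemma foldr_laguerre2_op_coeff:
  assumes "b - real (sum_list (map n js)) > -1"
  shows "\<exists>q. (\<forall>x>0. foldr (\<lambda>j. laguerre2_op (c j) (n j)) js (\<lambda>x. x powr b) x
       = x powr (b - real (sum_list (map n js))) * poly q x) \<and>
    (\<forall>i. coeff q i * Gamma (b - real (sum_list (map n js)) + real i + 1) =
       Gamma (b + 1) * fps_nth (\<Prod>j\<leftarrow>js. (1 - fps_const (c j) * fps_X) ^ n j) i)"
  using assms
proof (induction js)
  case Nil
  show ?case by (rule exI[of _ 1]) (auto simp: coeff_eq_0)
next
  case (Cons j js)
  let ?s = "sum_list (map n js)"
  let ?f = "foldr (\<lambda>j. laguerre2_op (c j) (n j)) js (\<lambda>x. x powr b)"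
  let ?E = "\<Prod>j\<leftarrow>js. (1 - fps_const (c j) * fps_X) ^ n j"
  from Cons obtain q where q: "\<And>x. x > 0 \<Longrightarrow> ?f x = x powr (b - real ?s) * poly q x"
    "\<And>i. coeff q i * Gamma (b - real ?s + real i + 1) = Gamma (b + 1) * fps_nth ?E i"
    by auto
  have "\<exists>p. (\<forall>x>0. (deriv ^^ n j) (\<lambda>x. exp (- c j * x) * ?f x) x =
          exp (- c j * x) * x powr (b - real ?s - real (n j)) * poly p x) \<and>
      (\<forall>i. coeff p i * Gamma (b - real ?s - real (n j) + real i + 1) =
         fps_nth ((1 - fps_const (c j) * fps_X) ^ n j * (fps_const (Gamma (b + 1)) * ?E)) i)"
    by (rule deriv_steps_coeff[where p = q]) (use q Cons.prems in auto)
  then obtain p where p: "\<And>x. x > 0 \<Longrightarrow> (deriv ^^ n j) (\<lambda>x. exp (- c j * x) * ?f x) x =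
          exp (- c j * x) * x powr (b - real ?s - real (n j)) * poly p x"
      "\<And>i. coeff p i * Gamma (b - real ?s - real (n j) + real i + 1) =
         fps_nth (fps_const (Gamma (b + 1)) * ((1 - fps_const (c j) * fps_X) ^ n j * ?E)) i"
    by (auto simp: mult.left_commute simp del: fps_mult_left_const_nth)
  have "foldr (\<lambda>j. laguerre2_op (c j) (n j)) (j # js) (\<lambda>x. x powr b) x
      = x powr (b - real (sum_list (map n (j # js)))) * poly p x" if "x > 0" for x
    using p(1)[OF that] by (simp add: laguerre2_op_def exp_minus algebra_simps)
  moreover have "coeff p i * Gamma (b - real (sum_list (map n (j # js))) + real i + 1) =
       Gamma (b + 1) * fps_nth (\<Prod>j\<leftarrow>j # js. (1 - fps_const (c j) * fps_X) ^ n j) i" for i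
    using p(2)[of i] by (simp add: algebra_simps)
  ultimately show ?case by blast
qed

text \<open>The start exponent is \<open>N + \<alpha>\<close> with
  \<open>N = multi_size r n\<close>, and N differentiations bring it down to
  \<open>\<alpha>\<close>. The Gamma factors at both ends, each divided by
  \<open>Gamma (\<alpha> + 1)\<close>, become the two Pochhammer symbols.\<close>

lemma coeff_mult_laguerre2:
  assumes \<alpha>: "\<alpha> > -1" and c: "\<And>j. j \<in> {1..r} \<Longrightarrow> c j > 0"
  shows "(-1) ^ multi_size r n * (\<Prod>j=1..r. c j ^ n j) * coeff (mult_laguerre2 \<alpha> r c n) i /
      pochhammer (\<alpha> + 1) (multi_size r n) =
    fps_nth (\<Prod>j=1..r. (1 - fps_const (c j) * fps_X) ^ n j) i / pochhammer (\<alpha> + 1) i"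
proof -
  let ?N = "multi_size r n"
  define k where "k = (-1) ^ ?N * (\<Prod>j=1..r. c j ^ n j)"
  define L where "L = mult_laguerre2 \<alpha> r c n"
  let ?E = "\<Prod>j=1..r. (1 - fps_const (c j) * fps_X) ^ n j"
  have E: "(\<Prod>j\<leftarrow>[1..<Suc r]. (1 - fps_const (c j) * fps_X) ^ n j) = ?E"
    by (subst prod.distinct_set_conv_list[symmetric])
       (auto simp: atLeastLessThanSuc_atLeastAtMost simp del: upt_Suc)
  from foldr_laguerre2_op_coeff[of "real ?N + \<alpha>" n "[1..<Suc r]" c] obtain q where
    q: "\<And>x. x > 0 \<Longrightarrow> laguerre2_rodrigues \<alpha> r c n x = x powr \<alpha> * poly q x"
      "\<And>i. coeff q i * Gamma (\<alpha> + real i + 1) = Gamma (real ?N + \<alpha> + 1) * fps_nth ?E i"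
    using \<alpha> unfolding sum_list_multi_size laguerre2_rodrigues_def E by auto
  have "is_mult_laguerre2 \<alpha> r c n L"
    unfolding L_def by (rule is_mult_laguerre2_mult_laguerre2[OF c])
  \<comment> \<open>Both polynomials represent the Rodrigues expression for positive x. Their
    difference therefore has infinitely many roots and vanishes.\<close>
  then have "poly (smult k L - q) x = 0" if "x > 0" for x
    using q(1)[OF that] that unfolding is_mult_laguerre2_def k_def by force
  then have "{0<..} \<subseteq> {x. poly (smult k L - q) x = 0}" by auto
  then have "infinite {x. poly (smult k L - q) x = 0}" using infinite_Ioi finite_subset by blast
  then have q_eq: "smult k L = q" using poly_roots_finite[of "smult k L - q"] by auto
  have poch: "pochhammer (\<alpha> + 1) m = Gamma (\<alpha> + real m + 1) / Gamma (\<alpha> + 1)" for m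
    using \<alpha> by (subst pochhammer_Gamma) (auto dest: nonpos_Ints_nonpos simp: add_ac)
  have "Gamma (\<alpha> + real m + 1) > 0" for m using \<alpha> by (intro Gamma_real_pos) auto
  from this[of i] this[of ?N] this[of 0] have "coeff q i / pochhammer (\<alpha> + 1) ?N = fps_nth ?E i / pochhammer (\<alpha> + 1) i"
    using q(2)[of i] unfolding poch by (simp add: field_simps add_ac)
  then show ?thesis unfolding k_def L_def q_eq[symmetric] by simp
qed

section \<open>Limits, majorants and scaling for products of formal power series\<close>

text \<open>A coefficient of a product of two series is a finite sum of products of coefficients, so
  coefficientwise limits pass to finite products.\<close>

lemma tendsto_fps_nth_prod:
  fixes f :: "'a \<Rightarrow> 'b \<Rightarrow> 'c::real_normed_field fps"
  assumes "\<And>j i. j \<in> A \<Longrightarrow> ((\<lambda>n. fps_nth (f n j) i) \<longlongrightarrow> fps_nth (g j) i) F"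
  shows "((\<lambda>n. fps_nth (\<Prod>j\<in>A. f n j) i) \<longlongrightarrow> fps_nth (\<Prod>j\<in>A. g j) i) F"
  using assms
proof (induction A arbitrary: i rule: infinite_finite_induct)
  case (insert a A)
  then show ?case by (auto simp: fps_mult_nth intro!: tendsto_intros)
qed auto

text \<open>The majorant principle: by the triangle inequality in the Cauchy product,
  coefficientwise domination is preserved under multiplication.\<close>

lemma norm_fps_nth_prod_le:
  fixes f :: "'a \<Rightarrow> 'c::real_normed_field fps"
  assumes "\<And>j i. j \<in> A \<Longrightarrow> norm (fps_nth (f j) i) \<le> fps_nth (g j) i"
  shows "norm (fps_nth (\<Prod>j\<in>A. f j) i) \<le> fps_nth (\<Prod>j\<in>A. g j) i"
  using assms
proof (induction A arbitrary: i rule: infinite_finite_induct)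
  case (insert a A)
  have "norm (fps_nth (f a) k * fps_nth (prod f A) (i - k)) \<le> fps_nth (g a) k * fps_nth (prod g A) (i - k)" for k
    unfolding norm_mult using insert by (intro mult_mono order_trans[OF norm_ge_zero]) auto
  then show ?case using insert by (auto simp: fps_mult_nth intro!: sum_norm_le)
qed auto

lemma fps_nth_one_minus_const_X_power:
  fixes c :: "'a::field_char_0"
  shows "fps_nth ((1 - fps_const c * fps_X) ^ m) i = of_nat (m choose i) * (- c) ^ i"
proof (induction m arbitrary: i)
  case 0
  show ?case by (cases i) auto
next
  case (Suc m)
  have "(1 - fps_const c * fps_X) ^ Suc m =
      (1 - fps_const c * fps_X) ^ m - fps_const c * (fps_X * (1 - fps_const c * fps_X) ^ m)"
    by (simp add: algebra_simps)
  then show ?case using Suc by (cases i) (auto simp: algebra_simps)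
qed

lemma fps_exp_sum:
  fixes f :: "'a \<Rightarrow> 'b::field_char_0"
  assumes "finite A"
  shows "fps_exp (\<Sum>j\<in>A. f j) = (\<Prod>j\<in>A. fps_exp (f j))"
  using assms by induction (auto simp: fps_exp_add_mult)

text \<open>Substituting \<open>t * X\<close> for X scales coefficient i by \<open>t ^ i\<close> and
  turns each \<open>c j\<close> into \<open>c j * t\<close>. With
  \<open>t = inverse (real n)\<close> this moves the scaling of \<open>z / n\<close> into the
  factors.\<close>

lemma fps_nth_scaled_prod:
  fixes c :: "'a \<Rightarrow> 'b::field_char_0"
  shows "t ^ i * fps_nth (\<Prod>j\<in>A. (1 - fps_const (c j) * fps_X) ^ m j) i =
    fps_nth (\<Prod>j\<in>A. (1 - fps_const (c j * t) * fps_X) ^ m j) i"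
proof -
  let ?P = "\<Prod>j\<in>A. (1 - fps_const (c j) * fps_X) ^ m j"
  have "(1 - fps_const (c j) * fps_X) oo (fps_const t * fps_X) = 1 - fps_const (c j * t) * fps_X" for j
    by (simp add: fps_compose_sub_distrib fps_compose_mult_distrib mult.assoc flip: fps_const_mult)
  then have "?P oo (fps_const t * fps_X) = (\<Prod>j\<in>A. (1 - fps_const (c j * t) * fps_X) ^ m j)"
    by (simp add: fps_compose_prod_distrib flip: fps_compose_power)
  moreover have "fps_nth (?P oo (fps_const t * fps_X)) i = t ^ i * fps_nth ?P i"
    by (simp only: fps_compose_linear fps_nth_Abs_fps)
  ultimately show ?thesis by simp
qed

section \<open>Asymptotics of the factors with floor exponents\<close>

lemma tendsto_floor_mult_divide:
  assumes "q \<ge> 0"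
  shows "(\<lambda>n. real (nat \<lfloor>q * real n\<rfloor>) / real n) \<longlonglongrightarrow> q"
proof (rule tendsto_sandwich)
  \<comment> \<open>The floor loses less than 1, which becomes \<open>1 / real n\<close> after
    division.\<close>
  show "\<forall>\<^sub>F n in sequentially. q - 1 / real n \<le> real (nat \<lfloor>q * real n\<rfloor>) / real n"
    using eventually_gt_at_top[of 0]
  proof eventually_elim
    case (elim n)
    have "q * real n - 1 \<le> real (nat \<lfloor>q * real n\<rfloor>)" using assms by linarith
    then have "(q * real n - 1) / real n \<le> real (nat \<lfloor>q * real n\<rfloor>) / real n"
      by (rule divide_right_mono) auto
    then show ?case using elim by (simp add: diff_divide_distrib)
  qed
  show "\<forall>\<^sub>F n in sequentially. real (nat \<lfloor>q * real n\<rfloor>) / real n \<le> q"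
    using eventually_gt_at_top[of 0]
  proof eventually_elim
    case (elim n)
    have "real (nat \<lfloor>q * real n\<rfloor>) \<le> q * real n" using assms by (simp add: of_nat_nat)
    then show ?case using elim by (simp add: field_simps)
  qed
  show "(\<lambda>n. q - 1 / real n) \<longlonglongrightarrow> q" using tendsto_diff[OF tendsto_const lim_1_over_n, of q] by simp
qed auto

text \<open>For fixed i the binomial coefficient is a product of i factors \<open>m n - k\<close>
  over \<open>fact i\<close>. Spreading the i powers of \<open>1 / n\<close> over these factors
  makes each of them tend to q, since \<open>k / n\<close> tends to 0.\<close>

lemma tendsto_choose_mult_power:
  fixes m :: "nat \<Rightarrow> nat" and c q :: real
  assumes "(\<lambda>n. real (m n) / real n) \<longlonglongrightarrow> q"
  shows "(\<lambda>n. real (m n choose i) * (c * inverse (real n)) ^ i) \<longlonglongrightarrow> (q * c) ^ i / fact i"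
proof -
  have "real (m n choose i) * (c * inverse (real n)) ^ i =
      (\<Prod>k<i. (real (m n) / real n - real k * (1 / real n)) * c) / fact i" for n
  proof -
    have "real (m n choose i) * (c * inverse (real n)) ^ i =
        (\<Prod>k<i. real (m n) - real k) / fact i * (\<Prod>k<i. c * inverse (real n))"
      by (simp add: binomial_gbinomial gbinomial_prod_rev atLeast0LessThan)
    also have "\<dots> = (\<Prod>k<i. (real (m n) - real k) * (c * inverse (real n))) / fact i"
      unfolding prod.distrib by simp
    also have "\<dots> = (\<Prod>k<i. (real (m n) / real n - real k * (1 / real n)) * c) / fact i"
      by (intro arg_cong2[where f = "(/)"] prod.cong refl) (simp add: divide_inverse algebra_simps)
    finally show ?thesis .
  qed
  moreover have "(\<lambda>n. (\<Prod>k<i. (real (m n) / real n - real k * (1 / real n)) * c) / fact i) \<longlonglongrightarrow>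
      (\<Prod>k<i. (q - real k * 0) * c) / fact i"
    by (intro tendsto_intros assms lim_1_over_n) auto
  ultimately show ?thesis by simp
qed

text \<open>Combines \<open>m choose i \<le> m ^ i / fact i\<close> with
  \<open>m \<le> q * n\<close>. The bound is free of n, as a dominating sequence must be.\<close>

lemma choose_mult_power_le:
  fixes c q :: real
  assumes "c \<ge> 0" "q \<ge> 0"
  shows "real (nat \<lfloor>q * real n\<rfloor> choose i) * (c * inverse (real n)) ^ i \<le> (q * c) ^ i / fact i"
proof -
  let ?m = "nat \<lfloor>q * real n\<rfloor>"
  have "real (?m choose i) * fact i \<le> real ?m ^ i"
    using of_nat_mono[OF binomial_fact_pow[of ?m i], where 'a = real] by simp
  then have "real (?m choose i) \<le> real ?m ^ i / fact i" by (simp add: field_simps)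
  then have "real (?m choose i) * (c * inverse (real n)) ^ i \<le> real ?m ^ i / fact i * (c * inverse (real n)) ^ i"
    using assms by (intro mult_right_mono) auto
  also have "\<dots> = (real ?m * inverse (real n) * c) ^ i / fact i"
    by (simp add: power_mult_distrib)
  also have "\<dots> \<le> (q * c) ^ i / fact i"
  proof -
    have "real ?m \<le> q * real n" using assms by (simp add: of_nat_nat)
    \<comment> \<open>At \<open>n = 0\<close> the inverse is 0 and the claim reduces to
      \<open>q \<ge> 0\<close>.\<close>
    then have "real ?m * inverse (real n) \<le> q"
      using assms by (cases "n = 0") (auto simp: field_simps)
    then show ?thesis
      using assms by (intro divide_right_mono power_mono mult_right_mono) auto
  qed
  finally show ?thesis .
qed

text \<open>Factor j converges to \<open>exp (- q j * c j * X)\<close> and is majorised by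
  \<open>exp (q j * c j * X)\<close>. The products of these exponentials are the exponentials of the
  sums.\<close>

lemma
  fixes c q :: "'a \<Rightarrow> real"
  assumes "finite A" "\<And>j. j \<in> A \<Longrightarrow> c j \<ge> 0" "\<And>j. j \<in> A \<Longrightarrow> q j \<ge> 0"
  defines "P \<equiv> \<lambda>n. \<Prod>j\<in>A. (1 - fps_const (c j * inverse (real n)) * fps_X) ^ nat \<lfloor>q j * real n\<rfloor>"
  shows tendsto_fps_nth_prod_floor: "(\<lambda>n. fps_nth (P n) i) \<longlonglongrightarrow> (- (\<Sum>j\<in>A. q j * c j)) ^ i / fact i"
    and fps_nth_prod_floor_le: "\<bar>fps_nth (P n) i\<bar> \<le> (\<Sum>j\<in>A. q j * c j) ^ i / fact i"
proof -
  have "(\<lambda>n. fps_nth (P n) i) \<longlonglongrightarrow> fps_nth (\<Prod>j\<in>A. fps_exp (q j * - c j)) i"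
    unfolding P_def
  proof (rule tendsto_fps_nth_prod)
    fix j i assume "j \<in> A"
    \<comment> \<open>The limit is taken at \<open>- c j\<close>, which accounts for the sign in
      \<open>(- c) ^ i\<close>.\<close>
    then show "(\<lambda>n. fps_nth ((1 - fps_const (c j * inverse (real n)) * fps_X) ^ nat \<lfloor>q j * real n\<rfloor>) i)
        \<longlonglongrightarrow> fps_nth (fps_exp (q j * - c j)) i"
      using tendsto_choose_mult_power[OF tendsto_floor_mult_divide, of "q j" i "- c j"] assms
      by (simp add: fps_nth_one_minus_const_X_power)
  qed
  then show "(\<lambda>n. fps_nth (P n) i) \<longlonglongrightarrow> (- (\<Sum>j\<in>A. q j * c j)) ^ i / fact i"
    using assms(1) by (simp add: sum_negf flip: fps_exp_sum)
  have "norm (fps_nth (P n) i) \<le> fps_nth (\<Prod>j\<in>A. fps_exp (q j * c j)) i"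
    unfolding P_def
  proof (rule norm_fps_nth_prod_le)
    fix j i assume "j \<in> A"
    then show "norm (fps_nth ((1 - fps_const (c j * inverse (real n)) * fps_X) ^ nat \<lfloor>q j * real n\<rfloor>) i)
        \<le> fps_nth (fps_exp (q j * c j)) i"
      using choose_mult_power_le[of "c j" "q j" n i] assms
      by (simp add: fps_nth_one_minus_const_X_power abs_mult power_abs)
  qed
  then show "\<bar>fps_nth (P n) i\<bar> \<le> (\<Sum>j\<in>A. q j * c j) ^ i / fact i"
    using assms(1) by (simp flip: fps_exp_sum)
qed

section \<open>Convergence of power series with dominated coefficients\<close>

lemma summable_power_over_fact_pochhammer:
  fixes a s R :: real
  assumes "a > 0" "s \<ge> 0" "R \<ge> 0"
  shows "summable (\<lambda>k. s ^ k / (fact k * pochhammer a k) * R ^ k)"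
proof (rule summable_comparison_test')
  have ge1: "pochhammer (a + 1) k \<ge> 1" for k
    using assms by (induction k) (auto simp: pochhammer_Suc intro: mult_ge1_I)
  \<comment> \<open>The symbol is 1 for \<open>k = 0\<close>; otherwise it is a times a product of
    factors above 1. As a may be less than 1, the lower bound is \<open>min 1 a\<close>, and
    comparison with an exponential series follows.\<close>
  have ge: "pochhammer a k \<ge> min 1 a" for k
  proof (cases k)
    case (Suc l)
    have "a * 1 \<le> a * pochhammer (a + 1) l" using assms ge1 by (intro mult_left_mono) auto
    then show ?thesis using Suc by (simp add: pochhammer_rec)
  qed auto
  show "summable (\<lambda>k. inverse (min 1 a) * (inverse (fact k) * (s * R) ^ k))"
    by (intro summable_mult summable_exp)
  show "norm (s ^ k / (fact k * pochhammer a k) * R ^ k) \<le> inverse (min 1 a) * (inverse (fact k) * (s * R) ^ k)"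
    for k
  proof -
    have "pochhammer a k > 0" using assms by (simp add: pochhammer_pos)
    moreover have "inverse (pochhammer a k) \<le> inverse (min 1 a)"
      using ge assms by (intro le_imp_inverse_le) auto
    then have "inverse (pochhammer a k) * (inverse (fact k) * (s * R) ^ k) \<le> inverse (min 1 a) * (inverse (fact k) * (s * R) ^ k)"
      using assms by (intro mult_right_mono) auto
    ultimately show ?thesis
      using assms by (simp add: abs_mult field_simps power_mult_distrib)
  qed
qed

text \<open>If R bounds the norms on K, the distance of the two series at any point of K is at most
  \<open>\<Sum>i. norm (b n i - l i) * R ^ i\<close>. This is independent of z and tends to 0 by
  Tannery's theorem with dominating terms \<open>2 * (B i * R ^ i)\<close>.\<close>

lemma uniform_limit_powser:
  fixes b :: "nat \<Rightarrow> nat \<Rightarrow> 'a::{real_normed_field,banach}"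
  assumes lim: "\<And>i. (\<lambda>n. b n i) \<longlonglongrightarrow> l i"
    and bound: "\<And>n i. norm (b n i) \<le> B i"
    and summ: "\<And>R. R \<ge> 0 \<Longrightarrow> summable (\<lambda>i. B i * R ^ i)"
    and "bounded K"
  shows "uniform_limit K (\<lambda>n z. \<Sum>i. b n i * z ^ i) (\<lambda>z. \<Sum>i. l i * z ^ i) sequentially"
proof -
  obtain R where R: "R > 0" "\<And>z. z \<in> K \<Longrightarrow> norm z \<le> R"
    using \<open>bounded K\<close> bounded_pos by metis
  \<comment> \<open>The bound survives the limit, so the differences \<open>b n i - l i\<close> are
    dominated by \<open>2 * B i\<close>.\<close>
  have lB: "norm (l i) \<le> B i" for i
    by (rule Lim_bounded[OF tendsto_norm[OF lim], of 0]) (use bound in auto)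
  have diff: "norm (b n i - l i) * R ^ i \<le> 2 * (B i * R ^ i)" for n i
  proof -
    have "norm (b n i - l i) \<le> 2 * B i"
      using norm_triangle_ineq4[of "b n i" "l i"] bound[of n i] lB[of i] by linarith
    then show ?thesis using R(1) mult_right_mono[of "norm (b n i - l i)" "2 * B i" "R ^ i"] by simp
  qed
  have summ2: "summable (\<lambda>i. 2 * (B i * R ^ i))" using R(1) by (intro summable_mult summ) auto
  have "(\<lambda>n. \<Sum>i. norm (b n i - l i) * R ^ i) \<longlonglongrightarrow> (\<Sum>i. 0 :: real)"
  proof (rule tannerys_theorem[THEN conjunct2, THEN conjunct2])
    show "(\<lambda>n. norm (b n i - l i) * R ^ i) \<longlonglongrightarrow> 0" for i
      using tendsto_mult[OF tendsto_norm[OF tendsto_diff[OF lim[of i] tendsto_const[of "l i"]]] tendsto_const[of "R ^ i"]]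
      by simp
    show "\<forall>\<^sub>F (i, n) in at_top \<times>\<^sub>F sequentially. norm (norm (b n i - l i) * R ^ i) \<le> 2 * (B i * R ^ i)"
      using diff R(1) by (intro always_eventually) (auto simp: abs_mult)
  qed (use summ2 in auto)
  then have T: "(\<lambda>n. \<Sum>i. norm (b n i - l i) * R ^ i) \<longlonglongrightarrow> 0" by simp
  have pw: "summable (\<lambda>i. f i * z ^ i)" if "\<And>i. norm (f i) \<le> B i" for f :: "nat \<Rightarrow> 'a" and z
    by (rule summable_comparison_test'[OF summ[of "norm z"]])
       (use that in \<open>auto simp: norm_mult norm_power intro!: mult_right_mono\<close>)
  have "dist (\<Sum>i. b n i * z ^ i) (\<Sum>i. l i * z ^ i) \<le> (\<Sum>i. norm (b n i - l i) * R ^ i)" if "z \<in> K" for n z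
  proof -
    have "(\<Sum>i. b n i * z ^ i) - (\<Sum>i. l i * z ^ i) = (\<Sum>i. (b n i - l i) * z ^ i)"
      using suminf_diff[OF pw[OF bound] pw[OF lB]] by (simp add: algebra_simps)
    also have "norm \<dots> \<le> (\<Sum>i. norm (b n i - l i) * R ^ i)"
    proof (rule norm_suminf_le)
      show "norm ((b n i - l i) * z ^ i) \<le> norm (b n i - l i) * R ^ i" for i
        using R that by (auto simp: norm_mult norm_power intro!: mult_left_mono power_mono)
      show "summable (\<lambda>i. norm (b n i - l i) * R ^ i)"
        by (rule summable_comparison_test'[OF summ2]) (use diff R(1) in \<open>auto simp: abs_mult\<close>)
    qed
    finally show ?thesis by (simp add: dist_norm)
  qed
  note le = this
  show ?thesis
    unfolding uniform_limit_iff
  proof (intro allI impI)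
    fix e :: real assume "e > 0"
    from order_tendstoD(2)[OF T this]
    show "\<forall>\<^sub>F n in sequentially. \<forall>z\<in>K. dist (\<Sum>i. b n i * z ^ i) (\<Sum>i. l i * z ^ i) < e"
      by eventually_elim (use le in \<open>auto intro: le_less_trans\<close>)
  qed
qed

section \<open>The Bessel limit as an entire power series\<close>

text \<open>The function under \<open>remove_sings\<close> agrees off 0 with the continuous function
  H given by the power series. Its limit at every z, including 0, is therefore \<open>H z\<close>,
  and this limit is what \<open>remove_sings\<close> returns.\<close>

lemma Gamma_times_remove_sings_bessel_J:
  fixes \<alpha> s :: real
  assumes \<alpha>: "\<alpha> > -1" and s: "s > 0"
  shows "Gamma (of_real \<alpha> + 1) *
      remove_sings (\<lambda>w. (of_real s * w) powr (- of_real \<alpha> / 2) * bessel_J (of_real \<alpha>) (2 * csqrt (of_real s * w))) z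
    = (\<Sum>k. of_real ((- s) ^ k / (fact k * pochhammer (\<alpha> + 1) k)) * z ^ k)"
proof -
  define l :: "nat \<Rightarrow> complex" where "l k = of_real ((- s) ^ k / (fact k * pochhammer (\<alpha> + 1) k))" for k
  have Gpos: "Gamma (\<alpha> + 1) > 0" using \<alpha> by (intro Gamma_real_pos) auto
  have G: "Gamma (of_real \<alpha> + 1 :: complex) = of_real (Gamma (\<alpha> + 1))"
    by (simp flip: Gamma_complex_of_real)
  have summ: "summable (\<lambda>k. l k * w ^ k)" for w
  proof (rule summable_comparison_test'[OF summable_power_over_fact_pochhammer[of "\<alpha> + 1" s "norm w"]])
    show "norm (l k * w ^ k) \<le> s ^ k / (fact k * pochhammer (\<alpha> + 1) k) * norm w ^ k" for k
      using \<alpha> s pochhammer_pos[of "\<alpha> + 1" k]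
      by (simp add: l_def norm_mult norm_divide norm_power abs_mult power_abs)
  qed (use \<alpha> s in auto)
  define H where "H w = (\<Sum>k. l k * w ^ k) / Gamma (of_real \<alpha> + 1)" for w
  have "isCont H z"
    unfolding H_def using Gpos isCont_powser_converges_everywhere[OF summ] G by (intro continuous_intros) auto
  then have limH: "H \<midarrow>z\<rightarrow> H z" by (simp add: isCont_def)
  have off0: "(of_real s * w) powr (- of_real \<alpha> / 2) * bessel_J (of_real \<alpha>) (2 * csqrt (of_real s * w)) = H w"
    if "w \<noteq> 0" for w
  proof -
    let ?u = "of_real s * w"
    have u: "?u \<noteq> 0" using that s by simp
    \<comment> \<open>Halving the imaginary part of the principal logarithm keeps it in the
      principal strip. Hence the two powers cancel exactly, even on the branch cut.\<close>
    have "Ln (csqrt ?u) = Ln ?u / 2"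
      using u Im_Ln_le_pi[OF u] mpi_less_Im_Ln[OF u] pi_gt_zero by (simp add: csqrt_exp_Ln Ln_exp)
    then have "?u powr (- of_real \<alpha> / 2) * csqrt ?u powr of_real \<alpha> =
        exp (- of_real \<alpha> / 2 * Ln ?u + of_real \<alpha> * (Ln ?u / 2))"
      using u by (simp only: exp_add powr_def csqrt_eq_0 if_False)
    then have "?u powr (- of_real \<alpha> / 2) * csqrt ?u powr of_real \<alpha> = 1" by simp
    \<comment> \<open>In \<open>bessel_J\<close> the argument \<open>2 * csqrt ?u\<close> is halved
      and occurs only in even powers, so the root disappears and powers of \<open>?u\<close>
      remain.\<close>
    moreover have "(-1) ^ k / (fact k * Gamma (of_real \<alpha> + of_nat k + 1)) * csqrt ?u ^ (2 * k)
        = l k * w ^ k / Gamma (of_real \<alpha> + 1)" for k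
    proof -
      have "pochhammer (\<alpha> + 1) k = Gamma (\<alpha> + real k + 1) / Gamma (\<alpha> + 1)"
        using \<alpha> by (subst pochhammer_Gamma) (auto dest: nonpos_Ints_nonpos simp: add_ac)
      moreover have "Gamma (of_real \<alpha> + of_nat k + 1 :: complex) = of_real (Gamma (\<alpha> + real k + 1))"
        by (simp flip: Gamma_complex_of_real)
      moreover have "(- s) ^ k = (-1) ^ k * s ^ k" by (simp flip: power_mult_distrib)
      ultimately show ?thesis
        using Gpos unfolding l_def G by (simp add: power_mult power_mult_distrib)
    qed
    ultimately show ?thesis
      using u suminf_divide[OF summ[of w], of "Gamma (of_real \<alpha> + 1)"]
      unfolding bessel_J_def H_def by (simp add: mult.assoc[symmetric])
  qed
  \<comment> \<open>Only a punctured neighbourhood of z matters, and points close to z but different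
    from it are eventually nonzero, also for \<open>z = 0\<close>.\<close>
  have "(\<lambda>w. (of_real s * w) powr (- of_real \<alpha> / 2) * bessel_J (of_real \<alpha>) (2 * csqrt (of_real s * w))) \<midarrow>z\<rightarrow> H z"
    by (rule Lim_transform_eventually[OF limH])
       (use off0 eventually_neq_at_within[of 0 z UNIV] in \<open>auto elim!: eventually_mono\<close>)
  then show ?thesis
    using Gpos G by (simp add: remove_sings_eqI H_def l_def)
qed

section \<open>Assembling the limit theorem\<close>

text \<open>Puts all dependence on n into the coefficients of a power series in z, the form required
  by \<open>uniform_limit_powser\<close>.\<close>

lemma normalised_mult_laguerre2_powser:
  fixes z :: complex
  assumes "\<alpha> > -1" and "\<And>j. j \<in> {1..r} \<Longrightarrow> c j > 0"
  shows "(-1) ^ multi_size r m * (\<Prod>j=1..r. of_real (c j) ^ m j) *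
      (poly (map_poly of_real (mult_laguerre2 \<alpha> r c m)) (z / of_nat n) /
        pochhammer (of_real \<alpha> + 1) (multi_size r m)) =
    (\<Sum>i. of_real (fps_nth (\<Prod>j=1..r. (1 - fps_const (c j * inverse (real n)) * fps_X) ^ m j) i /
        pochhammer (\<alpha> + 1) i) * z ^ i)"
proof -
  let ?N = "multi_size r m"
  let ?L = "mult_laguerre2 \<alpha> r c m"
  define k where "k = (-1) ^ ?N * (\<Prod>j=1..r. c j ^ m j)"
  let ?a = "\<lambda>i. fps_nth (\<Prod>j=1..r. (1 - fps_const (c j * inverse (real n)) * fps_X) ^ m j) i / pochhammer (\<alpha> + 1) i"
  have a: "?a i = k * coeff ?L i / pochhammer (\<alpha> + 1) ?N * inverse (real n) ^ i" for i
  proof -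
    have "k * coeff ?L i / pochhammer (\<alpha> + 1) ?N =
        fps_nth (\<Prod>j=1..r. (1 - fps_const (c j) * fps_X) ^ m j) i / pochhammer (\<alpha> + 1) i"
      unfolding k_def by (rule coeff_mult_laguerre2) (use assms in auto)
    then show ?thesis by (simp flip: fps_nth_scaled_prod)
  qed
  have deg: "degree (map_poly complex_of_real ?L) = degree ?L" by (rule degree_map_poly) auto
  \<comment> \<open>By the formula for \<open>?a\<close>, the coefficients beyond the degree of
    \<open>?L\<close> vanish, so the series is a finite sum.\<close>
  have "(\<Sum>i. of_real (?a i) * z ^ i) = (\<Sum>i\<le>degree ?L. of_real (?a i) * z ^ i)"
    by (rule suminf_finite) (simp_all only: a, simp_all add: coeff_eq_0)
  also have "\<dots> = (\<Sum>i\<le>degree ?L. of_real k * (of_real (coeff ?L i) * (z / of_nat n) ^ i / of_real (pochhammer (\<alpha> + 1) ?N)))"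
    unfolding a by (intro sum.cong) (auto simp: power_divide field_simps)
  also have "\<dots> = of_real k * (poly (map_poly of_real ?L) (z / of_nat n) / of_real (pochhammer (\<alpha> + 1) ?N))"
    by (simp add: poly_altdef deg coeff_map_poly sum_distrib_left sum_divide_distrib)
  finally show ?thesis by (simp add: k_def flip: pochhammer_of_real)
qed

theorem theorem4:
  fixes \<alpha> :: real and r :: nat and c q :: "nat \<Rightarrow> real"
    and \<nu> :: "nat \<Rightarrow> nat \<Rightarrow> nat" and K :: "complex set"
  assumes "\<alpha> > -1"
    and "\<And>j. j \<in> {1..r} \<Longrightarrow> c j > 0"
    and "\<And>i j. i \<in> {1..r} \<Longrightarrow> j \<in> {1..r} \<Longrightarrow> i \<noteq> j \<Longrightarrow> c i \<noteq> c j"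
    and "\<And>j. j \<in> {1..r} \<Longrightarrow> q j > 0"
    and "(\<Sum>j=1..r. q j) = 1"
    and "\<And>n j. j \<in> {1..r} \<Longrightarrow> \<nu> n j = nat \<lfloor>q j * real n\<rfloor>"
    and "compact K"
  shows "uniform_limit K
    (\<lambda>n z. (-1) ^ multi_size r (\<nu> n) * (\<Prod>j=1..r. of_real (c j) ^ \<nu> n j) *
       (poly (map_poly of_real (mult_laguerre2 \<alpha> r c (\<nu> n))) (z / of_nat n) /
        pochhammer (of_real \<alpha> + 1) (multi_size r (\<nu> n))))
    (\<lambda>z. Gamma (of_real \<alpha> + 1) *
       remove_sings (\<lambda>w. (of_real (\<Sum>j=1..r. q j * c j) * w) powr (- of_real \<alpha> / 2) *
         bessel_J (of_real \<alpha>) (2 * csqrt (of_real (\<Sum>j=1..r. q j * c j) * w))) z)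
    sequentially"
proof -
  define s where "s = (\<Sum>j=1..r. q j * c j)"
  \<comment> \<open>An empty sum could not be 1. A nonempty index set makes s strictly positive, as
    the Bessel identity requires.\<close>
  have "{1..r} \<noteq> {}" using assms(5) by force
  then have s: "s > 0" unfolding s_def using assms(2,4) by (intro sum_pos) auto
  define P where "P n = (\<Prod>j=1..r. (1 - fps_const (c j * inverse (real n)) * fps_X) ^ nat \<lfloor>q j * real n\<rfloor>)" for n
  have P: "(\<Prod>j=1..r. (1 - fps_const (c j * inverse (real n)) * fps_X) ^ \<nu> n j) = P n" for n
    unfolding P_def using assms(6) by (intro prod.cong) auto
  have cq: "\<And>j. j \<in> {1..r} \<Longrightarrow> c j \<ge> 0" "\<And>j. j \<in> {1..r} \<Longrightarrow> q j \<ge> 0"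
    using assms(2,4) by (auto intro: less_imp_le)
  have poch: "pochhammer (\<alpha> + 1) i > 0" for i using assms(1) by (intro pochhammer_pos) auto
  have "uniform_limit K
     (\<lambda>n z. \<Sum>i. complex_of_real (fps_nth (P n) i / pochhammer (\<alpha> + 1) i) * z ^ i)
     (\<lambda>z. \<Sum>i. of_real ((- s) ^ i / (fact i * pochhammer (\<alpha> + 1) i)) * z ^ i) sequentially"
  \<comment> \<open>The majorant consists of the coefficients of \<open>exp (s * X)\<close>, divided
    by the same Pochhammer symbols as the series itself.\<close>
  proof (rule uniform_limit_powser[where B = "\<lambda>i. s ^ i / (fact i * pochhammer (\<alpha> + 1) i)"])
    fix n i
    have "(\<lambda>n. fps_nth (P n) i / pochhammer (\<alpha> + 1) i) \<longlonglongrightarrow> (- s) ^ i / fact i / pochhammer (\<alpha> + 1) i"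
      unfolding P_def s_def
      by (intro tendsto_divide tendsto_const tendsto_fps_nth_prod_floor cq) (use poch[of i] in auto)
    then show "(\<lambda>n. complex_of_real (fps_nth (P n) i / pochhammer (\<alpha> + 1) i)) \<longlonglongrightarrow>
        of_real ((- s) ^ i / (fact i * pochhammer (\<alpha> + 1) i))"
      by (intro tendsto_of_real) simp
    have "\<bar>fps_nth (P n) i\<bar> \<le> s ^ i / fact i"
      unfolding P_def s_def by (rule fps_nth_prod_floor_le) (use cq in auto)
    then show "norm (complex_of_real (fps_nth (P n) i / pochhammer (\<alpha> + 1) i)) \<le> s ^ i / (fact i * pochhammer (\<alpha> + 1) i)"
      unfolding norm_of_real using poch[of i] by (simp add: field_simps)
  next
    show "summable (\<lambda>i. s ^ i / (fact i * pochhammer (\<alpha> + 1) i) * R ^ i)" if "R \<ge> 0" for R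
      using that s assms(1) by (intro summable_power_over_fact_pochhammer) auto
    show "bounded K" using assms(7) by (rule compact_imp_bounded)
  qed
  moreover note normalised_mult_laguerre2_powser[where r = r and c = c and \<alpha> = \<alpha>, OF assms(1)]
  ultimately show ?thesis
    unfolding s_def[symmetric] Gamma_times_remove_sings_bessel_J[OF assms(1) s]
    by (simp only: assms(2) P)
qed

end
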